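(* For any integer $s\ge 5$, there are $s$ twistor lines which are not collinear.
   Context: Let $j:\mathbb{CP}^3\to\mathbb{CP}^3$ be the fixed-point-free anti-holomorphic involution $j[z_0,z_1,z_2,z_3]=[-\bar z_1,\bar z_0,-\bar z_3,\bar z_2]$. A projective line $l\subset\mathbb{CP}^3$ is a twistor line if $j(l)=l$; distinct twistor lines are disjoint. "$s$ twistor lines" means $s$ distinct twistor lines. A set of disjoint lines $L_1,\dots,L_s\subset\mathbb{CP}^3$ is said to be collinear if there is another line $R\subset\mathbb{CP}^3$ intersecting all of them. *)

theory Defs
  imports "HOL-Analysis.Analysis"
begin

definition proportional :: "complex^4 \<Rightarrow> complex^4 \<Rightarrow> bool" where
  "proportional v w \<longleftrightarrow> v \<noteq> 0 \<and> w \<noteq> 0 \<and> (\<exists>c. c \<noteq> 0 \<and> w = c *s v)"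

lemma part_equivp_proportional: "part_equivp proportional"
proof (rule part_equivpI)
  have "proportional (axis 1 1) (axis 1 1)"
    unfolding proportional_def by (metis axis_eq_0_iff one_neq_zero vec.scale_one)
  then show "\<exists>v. proportional v v" by blast
next
  show "symp proportional"
  proof (rule sympI)
    fix v w assume "proportional v w"
    then obtain c where c: "v \<noteq> 0" "w \<noteq> 0" "c \<noteq> 0" "w = c *s v"
      unfolding proportional_def by blast
    then have "v = inverse c *s w" by (simp add: vec.scale_scale)
    with c show "proportional w v"
      unfolding proportional_def by (metis nonzero_imp_inverse_nonzero)
  qed
next
  show "transp proportional"
  proof (rule transpI)
    fix u v w assume "proportional u v" "proportional v w"
    then obtain c d where "u \<noteq> 0" "w \<noteq> 0" "c \<noteq> 0" "d \<noteq> 0" "v = c *s u" "w = d *s v"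
      unfolding proportional_def by blast
    then show "proportional u w"
      unfolding proportional_def by (metis mult_eq_0_iff vec.scale_scale)
  qed
qed

text \<open>Complex projective 3-space: nonzero vectors of \<open>complex^4\<close> up to nonzero scalars.
  The relation is partial, so \<open>abs_cp3 v\<close> is the point with homogeneous coordinates \<open>v\<close>
  only when \<open>v \<noteq> 0\<close>.\<close>

quotient_type cp3 = "complex^4" / partial: proportional
  by (rule part_equivp_proportional)

text \<open>The homogeneous coordinate \<open>z\<^sub>i\<close> (\<open>i = 0, \<dots>, 3\<close>) is the component with index
  \<open>i + 1\<close>.\<close>

definition j_vec :: "complex^4 \<Rightarrow> complex^4" where
  "j_vec z = vector [- cnj (z $ 2), cnj (z $ 1), - cnj (z $ 4), cnj (z $ 3)]"

lemma j_vec_nth: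
  "j_vec z $ 1 = - cnj (z $ 2)" "j_vec z $ 2 = cnj (z $ 1)"
  "j_vec z $ 3 = - cnj (z $ 4)" "j_vec z $ 4 = cnj (z $ 3)"
  by (simp_all add: j_vec_def vector_def)

lemma j_vec_scale: "j_vec (c *s z) = cnj c *s j_vec z"
  by (simp add: vec_eq_iff forall_4 j_vec_nth)

lemma j_vec_eq_0_iff: "j_vec z = 0 \<longleftrightarrow> z = 0"
  by (auto simp: vec_eq_iff forall_4 j_vec_nth)

lift_definition twistor_inv :: "cp3 \<Rightarrow> cp3" is j_vec
  unfolding proportional_def by (metis complex_cnj_zero_iff j_vec_eq_0_iff j_vec_scale)

definition is_line :: "cp3 set \<Rightarrow> bool" where
  "is_line L \<longleftrightarrow> (\<exists>V :: (complex^4) set. vec.subspace V \<and> vec.dim V = 2 \<and> L = abs_cp3 ` (V - {0}))"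

definition twistor_line :: "cp3 set \<Rightarrow> bool" where
  "twistor_line L \<longleftrightarrow> is_line L \<and> twistor_inv ` L = L"

text \<open>Intended for sets of pairwise disjoint lines. \<open>R \<notin> A\<close> renders the word ``another'' in
  ``there is another line intersecting all of them''; it is automatic when \<open>A\<close> has at least two
  (disjoint) members.\<close>

definition collinear_lines :: "cp3 set set \<Rightarrow> bool" where
  "collinear_lines A \<longleftrightarrow> (\<exists>R. is_line R \<and> R \<notin> A \<and> (\<forall>L\<in>A. R \<inter> L \<noteq> {}))"

end

theory Submission
  imports Defs
begin

text \<open>Each nonzero \<open>p\<close> lies on the twistor line spanned by \<open>p\<close> and \<open>j p\<close>. Regard \<open>\<complex>\<^sup>4\<close> as
  \<open>\<complex>\<^sup>2 \<times> \<complex>\<^sup>2\<close>; then \<open>p = (1,0,a,b)\<close> gives the graph of the quaternion \<open>q\<close> acting on \<open>\<complex>\<^sup>2\<close> by the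
  matrix with columns \<open>(a,b)\<close> and \<open>(- cnj b, cnj a)\<close>. A line meeting \<open>\<complex>\<^sup>2 \<times> 0\<close> and \<open>0 \<times> \<complex>\<^sup>2\<close> is
  spanned by some \<open>(w,0)\<close> and \<open>(0,u)\<close>, and it meets the graph of \<open>q\<close> only if \<open>q w\<close> is a multiple of
  \<open>u\<close>. For \<open>q = 1\<close> this makes \<open>u\<close> and \<open>w\<close> proportional, so that \<open>w\<close> would be a common eigenvector of
  the quaternions \<open>(a,b) = (\<i>,0)\<close> and \<open>(a,b) = (0,1)\<close>, which do not have one. Hence these five
  twistor lines are not collinear, nor is any larger set.\<close>

text \<open>The quotient is partial, so equal classes give related representatives only inside the
  domain of \<open>proportional\<close>; the nonzero hypotheses put \<open>v\<close> and
  \<open>w\<close> there.\<close>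

lemma abs_cp3_eqD:
  assumes "abs_cp3 v = abs_cp3 w" "v \<noteq> 0" "w \<noteq> 0"
  shows "\<exists>c. c \<noteq> 0 \<and> w = c *s v"
proof -
  have "proportional v v" "proportional w w"
    using assms unfolding proportional_def by (metis one_neq_zero vec.scale_one)+
  then have "proportional v w"
    using Quotient3_rel[OF Quotient3_cp3, of v w] assms(1) by blast
  then show ?thesis unfolding proportional_def by blast
qed

lemma in_subspace_if_abs_cp3_in:
  assumes "vec.subspace V" "abs_cp3 v \<in> abs_cp3 ` (V - {0})" "v \<noteq> 0"
  shows "v \<in> V"
proof -
  obtain w where w: "w \<in> V - {0}" "abs_cp3 v = abs_cp3 w"
    using assms(2) by (elim imageE)
  then obtain c where "v = c *s w" using abs_cp3_eqD[of w v] assms(3) by auto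
  with w assms(1) show ?thesis by (simp add: vec.subspace_scale)
qed

lemma in_span_pair: "v \<in> vec.span {p, q} \<longleftrightarrow> (\<exists>c d. v = c *s p + d *s q)"
  for p q v :: "complex^'n"
proof
  assume "v \<in> vec.span {p, q}"
  then obtain c where "v - c *s p \<in> vec.span {q}" using vec.span_breakdown_eq by blast
  then obtain d where "v - c *s p = d *s q" by (auto simp: vec.span_singleton)
  then show "\<exists>c d. v = c *s p + d *s q" by (metis add.commute diff_add_cancel)
next
  assume "\<exists>c d. v = c *s p + d *s q"
  then show "v \<in> vec.span {p, q}"
    by (metis insertI1 insertI2 vec.span_add vec.span_base vec.span_scale)
qed

lemma independent_pair:
  fixes p q :: "complex^'n"
  assumes "p \<noteq> 0" "\<And>c. q \<noteq> c *s p"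
  shows "vec.independent {p, q}" "card {p, q} = 2"
proof -
  have "q \<noteq> p" using assms(2)[of 1] by auto
  then show "card {p, q} = 2" by simp
  have "vec.independent {q, p}"
    using assms \<open>q \<noteq> p\<close> by (auto simp: vec.independent_insert vec.span_singleton)
  then show "vec.independent {p, q}" by (simp add: insert_commute)
qed

lemma j_vec_j_vec: "j_vec (j_vec z) = - z"
  by (simp add: vec_eq_iff forall_4 j_vec_nth)

lemma j_vec_add: "j_vec (v + w) = j_vec v + j_vec w"
  by (simp add: vec_eq_iff forall_4 j_vec_nth)

text \<open>As \<open>j_vec\<close> is antilinear with square -1, an equality
  \<open>j_vec p = c *s p\<close> would force |c|^2 = -1. Hence \<open>p\<close> and
  \<open>j_vec p\<close> span a plane, that is, a projective line.\<close>

lemma j_vec_not_scale: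
  assumes "p \<noteq> 0" shows "j_vec p \<noteq> c *s p"
proof
  assume eq: "j_vec p = c *s p"
  have "- p = (cnj c * c) *s p"
    by (metis eq j_vec_j_vec j_vec_scale vec.scale_scale)
  then have "(cnj c * c + 1) *s p = 0"
    by (metis add.right_inverse add.commute vec.scale_left_distrib vec.scale_one)
  then have "cnj c * c + 1 = 0" using assms by (metis vec.scale_eq_0_iff)
  then have "Re (cnj c * c + 1) = 0" by simp
  then have "(Re c)\<^sup>2 + (Im c)\<^sup>2 + 1 = 0" by (simp add: power2_eq_square)
  then show False by (smt (verit) zero_le_power2)
qed

definition twistor_line_through :: "complex^4 \<Rightarrow> cp3 set" where
  "twistor_line_through p = abs_cp3 ` (vec.span {p, j_vec p} - {0})"

lemma j_vec_image_span:
  assumes "v \<in> vec.span {p, j_vec p}"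
  shows "j_vec v \<in> vec.span {p, j_vec p}"
proof -
  obtain c d where "v = c *s p + d *s j_vec p" using assms by (auto simp: in_span_pair)
  then have "j_vec v = (- cnj d) *s p + cnj c *s j_vec p"
    by (simp add: j_vec_add j_vec_scale j_vec_j_vec)
  then show ?thesis unfolding in_span_pair by blast
qed

lemma twistor_inv_abs:
  assumes "v \<noteq> 0" shows "twistor_inv (abs_cp3 v) = abs_cp3 (j_vec v)"
proof -
  have "proportional v v"
    using assms unfolding proportional_def by (metis one_neq_zero vec.scale_one)
  then show ?thesis by (rule twistor_inv.abs_eq[unfolded eq_onp_def])
qed

lemma twistor_line_twistor_line_through:
  assumes "p \<noteq> 0" shows "twistor_line (twistor_line_through p)"
  unfolding twistor_line_def
proof
  let ?V = "vec.span {p, j_vec p}"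
  have "vec.dim ?V = 2"
    using independent_pair[OF assms j_vec_not_scale[OF assms]]
    by (metis vec.dim_span vec.dim_eq_card_independent)
  then show "is_line (twistor_line_through p)"
    unfolding is_line_def twistor_line_through_def using vec.subspace_span by blast
  have sub: "twistor_inv ` twistor_line_through p \<subseteq> twistor_line_through p"
    unfolding twistor_line_through_def
    by (auto simp: twistor_inv_abs j_vec_eq_0_iff intro!: imageI j_vec_image_span)
  have "x \<in> twistor_inv ` twistor_line_through p" if x: "x \<in> twistor_line_through p" for x
  proof -
    obtain v where v: "v \<in> ?V" "v \<noteq> 0" "x = abs_cp3 v"
      using x unfolding twistor_line_through_def by blast
    \<comment> \<open>The square of \<open>j_vec\<close> is -1, so \<open>- j_vec v\<close> is a
      preimage of \<open>v\<close>.\<close>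
    define w where "w = - j_vec v"
    have w: "w \<in> ?V" "w \<noteq> 0" "j_vec w = v"
      using v(2) vec.span_neg[OF j_vec_image_span[OF v(1)]]
      by (simp_all add: w_def j_vec_eq_0_iff) (simp add: vec_eq_iff forall_4 j_vec_nth)
    then have "x = twistor_inv (abs_cp3 w)" using v by (simp add: twistor_inv_abs)
    with w show ?thesis unfolding twistor_line_through_def by blast
  qed
  with sub show "twistor_inv ` twistor_line_through p = twistor_line_through p" by blast
qed

lemma meets_twistor_line_through:
  assumes "vec.subspace W" "abs_cp3 ` (W - {0}) \<inter> twistor_line_through p \<noteq> {}"
  obtains v c d where "v = c *s p + d *s j_vec p" "v \<in> W" "v \<noteq> 0"
proof -
  obtain x where x: "x \<in> abs_cp3 ` (W - {0})" "x \<in> twistor_line_through p"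
    using assms(2) by (meson disjoint_iff)
  then obtain v where v: "v \<in> vec.span {p, j_vec p}" "v \<noteq> 0" "x = abs_cp3 v"
    unfolding twistor_line_through_def by blast
  then have "v \<in> W" using in_subspace_if_abs_cp3_in[OF assms(1)] x(1) by metis
  with v that show ?thesis unfolding in_span_pair by metis
qed

definition graph_vec :: "complex \<Rightarrow> complex \<Rightarrow> complex^4" where
  "graph_vec a b = vector [1, 0, a, b]"

lemma graph_vec_nth [simp]:
  "graph_vec a b $ 1 = 1" "graph_vec a b $ 2 = 0" "graph_vec a b $ 3 = a" "graph_vec a b $ 4 = b"
  by (simp_all add: graph_vec_def vector_def)

lemma graph_vec_nonzero: "graph_vec a b \<noteq> 0"
  by (simp add: vec_eq_iff forall_4)

lemma axis_4_nth [simp]: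
  "(axis 3 1 :: complex^4) $ 1 = 0" "(axis 3 1 :: complex^4) $ 2 = 0"
  "(axis 3 1 :: complex^4) $ 3 = 1" "(axis 3 1 :: complex^4) $ 4 = 0"
  by (simp_all add: axis_def)

text \<open>This infinite family pads the five special lines up to \<open>s\<close>. The first two
  coordinates of the spanning vectors are (1,0) and (0,1), which forces the coefficients 1 and 0 and
  leaves the third coordinate to be compared.\<close>

lemma inj_graph_line: "inj (\<lambda>n::nat. twistor_line_through (graph_vec (of_nat n) 0))"
proof (rule injI)
  fix m n :: nat
  let ?p = "\<lambda>n::nat. graph_vec (of_nat n) 0"
  assume eq: "twistor_line_through (?p m) = twistor_line_through (?p n)"
  have "?p m \<in> vec.span {?p m, j_vec (?p m)}" by (rule vec.span_base) (rule insertI1)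
  then have "abs_cp3 (?p m) \<in> twistor_line_through (?p m)"
    unfolding twistor_line_through_def by (intro imageI DiffI) (simp_all add: graph_vec_nonzero)
  then have "abs_cp3 (?p m) \<in> twistor_line_through (?p n)" unfolding eq .
  then have "?p m \<in> vec.span {?p n, j_vec (?p n)}"
    unfolding twistor_line_through_def
    by (rule in_subspace_if_abs_cp3_in[OF vec.subspace_span _ graph_vec_nonzero])
  then obtain c d where "?p m = c *s ?p n + d *s j_vec (?p n)"
    unfolding in_span_pair by blast
  then have "c = 1" "d = 0" "of_nat m = c * (of_nat n :: complex)"
    by (simp_all add: vec_eq_iff forall_4 j_vec_nth)
  then show "m = n" by simp
qed

lemma five_twistor_lines_no_transversal:
  assumes "is_line R"
    and "\<And>p. p \<in> {axis 3 1, graph_vec 0 0, graph_vec 1 0, graph_vec \<i> 0, graph_vec 0 1} \<Longrightarrow>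
          R \<inter> twistor_line_through p \<noteq> {}"
  shows False
proof -
  obtain W where W: "vec.subspace W" "vec.dim W = 2" and R: "R = abs_cp3 ` (W - {0})"
    using assms(1) unfolding is_line_def by blast
  note meets = meets_twistor_line_through[OF W(1), folded R, OF assms(2)]
  \<comment> \<open>In coordinates, w = (\<alpha>, \<beta>, 0, 0) and u = (0, 0, \<gamma>,
    \<delta>). Their supports are disjoint, so they form a basis of \<open>W\<close>.\<close>
  obtain w \<alpha> \<beta> where w: "w = \<alpha> *s graph_vec 0 0 + \<beta> *s j_vec (graph_vec 0 0)" "w \<in> W" "w \<noteq> 0"
    by (rule meets[of "graph_vec 0 0"]) simp
  obtain u \<gamma> \<delta> where u: "u = \<gamma> *s axis 3 1 + \<delta> *s j_vec (axis 3 1)" "u \<in> W" "u \<noteq> 0"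
    by (rule meets[of "axis 3 1"]) simp
  have w_nz: "\<alpha> \<noteq> 0 \<or> \<beta> \<noteq> 0" using w by auto
  have "u \<noteq> c *s w" for c
  proof
    assume "u = c *s w"
    then have "\<gamma> = 0" "\<delta> = 0" unfolding w(1) u(1)
      by (simp_all add: vec_eq_iff forall_4 j_vec_nth)
    with u show False by simp
  qed
  note indep = independent_pair[OF w(3) this]
  have W_sub: "W \<subseteq> vec.span {w, u}"
    by (rule vec.card_ge_dim_independent) (use w u indep W(2) in auto)
  \<comment> \<open>The right-hand sides are the entries of q(\<alpha>, \<beta>) for the quaternion
    q given by \<open>a\<close> and \<open>b\<close>; the claim is that this vector is a multiple of
    (\<gamma>, \<delta>).\<close>
  have key: "\<exists>e. e * \<gamma> = a * \<alpha> - cnj b * \<beta> \<and> e * \<delta> = b * \<alpha> + cnj a * \<beta>"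
    if R_meets: "graph_vec a b \<in> {axis 3 1, graph_vec 0 0, graph_vec 1 0, graph_vec \<i> 0, graph_vec 0 1}"
    for a b
  proof -
    obtain v x y where v: "v = x *s graph_vec a b + y *s j_vec (graph_vec a b)" "v \<in> W" "v \<noteq> 0"
      by (rule meets[OF R_meets])
    obtain c d where "v = c *s w + d *s u"
      using subsetD[OF W_sub v(2)] unfolding in_span_pair by metis
    then have xy: "x = c * \<alpha>" "y = c * \<beta>"
      and "c * \<alpha> * a - c * \<beta> * cnj b = d * \<gamma>" "c * \<alpha> * b + c * \<beta> * cnj a = d * \<delta>"
      unfolding v(1) w(1) u(1) by (auto simp: vec_eq_iff forall_4 j_vec_nth)
    then have "d * \<gamma> = c * (a * \<alpha> - cnj b * \<beta>)" "d * \<delta> = c * (b * \<alpha> + cnj a * \<beta>)"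
      by (simp_all add: algebra_simps)
    \<comment> \<open>With \<open>c = 0\<close>, both coefficients \<open>x\<close> and
      \<open>y\<close> of \<open>v\<close> would vanish.\<close>
    moreover have "c \<noteq> 0" using v xy by auto
    ultimately have "d / c * \<gamma> = a * \<alpha> - cnj b * \<beta>" "d / c * \<delta> = b * \<alpha> + cnj a * \<beta>"
      by simp_all
    then show ?thesis by blast
  qed
  obtain e where e: "e * \<gamma> = \<alpha>" "e * \<delta> = \<beta>" using key[of 1 0] by auto
  obtain f where f: "f * \<gamma> = \<i> * \<alpha>" "f * \<delta> = - \<i> * \<beta>" using key[of \<i> 0] by auto
  obtain g where g: "g * \<gamma> = - \<beta>" "g * \<delta> = \<alpha>" using key[of 0 1] by auto
  \<comment> \<open>Each key instance is cross-multiplied with \<gamma> and \<delta> to eliminate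
    its factor. The quaternions 1 and \<i> give opposite signs, so both products vanish.\<close>
  have 1: "\<alpha> * \<delta> = \<beta> * \<gamma>" using e by (metis mult.assoc mult.commute)
  have "\<i> * (\<alpha> * \<delta>) = - \<i> * (\<beta> * \<gamma>)" using f by (metis mult.assoc mult.commute)
  then have "\<alpha> * \<delta> = 0" "\<beta> * \<gamma> = 0" using 1 by auto
  \<comment> \<open>If \<alpha> is nonzero then \<delta> = 0, against
    \<open>g * \<delta> = \<alpha>\<close>; if \<beta> is nonzero then \<gamma> = 0, against
    \<open>g * \<gamma> = - \<beta>\<close>.\<close>
  then show False using w_nz e g by auto
qed

theorem corollary3p4:
  fixes s :: nat
  assumes "s \<ge> 5"
  shows "\<exists>A. finite A \<and> card A = s \<and> (\<forall>L\<in>A. twistor_line L) \<and> \<not> collinear_lines A"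
proof -
  let ?ps = "[axis 3 1, graph_vec 0 0, graph_vec 1 0, graph_vec \<i> 0, graph_vec 0 1]"
  let ?line = "\<lambda>n::nat. twistor_line_through (graph_vec (of_nat n) 0)"
  define F where "F = twistor_line_through ` set ?ps"
  have "card F \<le> card (set ?ps)" unfolding F_def by (rule card_image_le) simp
  also have "\<dots> \<le> length ?ps" by (rule card_length)
  \<comment> \<open>This bound keeps the natural-number difference \<open>s - card F\<close> from
    being truncated, so that many further lines bring the total to exactly \<open>s\<close>.\<close>
  finally have card_F: "card F \<le> s" using assms by simp
  have fin_F: "finite F" unfolding F_def by simp
  \<comment> \<open>The family shares lines with \<open>F\<close>, for instance at n = 0 and n = 1;
    removing \<open>F\<close> makes the padding disjoint from it.\<close>
  have "infinite (range ?line - F)"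
    using range_inj_infinite[OF inj_graph_line] fin_F by (rule Diff_infinite_finite[rotated])
  then obtain B where B: "finite B" "card B = s - card F" "B \<subseteq> range ?line - F"
    using infinite_arbitrarily_large by blast
  have "card (F \<union> B) = card F + card B"
    by (rule card_Un_disjoint) (use B fin_F in auto)
  then have card: "card (F \<union> B) = s" using B(2) card_F by simp
  have "\<forall>p\<in>set ?ps. p \<noteq> 0" by (simp add: graph_vec_nonzero)
  then have "\<forall>L\<in>F. twistor_line L"
    unfolding F_def using twistor_line_twistor_line_through by blast
  moreover have "\<forall>L\<in>range ?line. twistor_line L"
    using twistor_line_twistor_line_through[OF graph_vec_nonzero] by blast
  ultimately have "\<forall>L\<in>F \<union> B. twistor_line L" using B(3) by blast
  moreover have "\<not> collinear_lines (F \<union> B)"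
  proof
    assume "collinear_lines (F \<union> B)"
    then obtain R where R: "is_line R" "\<And>L. L \<in> F \<Longrightarrow> R \<inter> L \<noteq> {}"
      unfolding collinear_lines_def by blast
    have "R \<inter> twistor_line_through p \<noteq> {}" if "p \<in> set ?ps" for p
      by (rule R(2)) (use that in \<open>unfold F_def, rule imageI\<close>)
    then show False using five_twistor_lines_no_transversal[OF R(1)] by simp
  qed
  ultimately show ?thesis using B(1) fin_F card by blast
qed

end
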